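(* For every integer $n\ge 2$, $$2n\binom{2n}{n}\ \Big|\ \sum_{k=0}^{n-1}(3k+1)\binom{2k}{k}^3 16^{\,n-1-k}.$$
   Context: Divisibility is in the integers. *)

theory Defs
  imports Complex_Main
begin

end

theory Submission
  imports Defs
begin

text \<open>
  Write \<open>c\<^sub>i\<close> for the central binomial coefficients and \<open>S(m,k) = (2m)! (2k)! / (m! k! (m+k)!)\<close>
  for the super Catalan numbers. The summand is the case \<open>k = 0\<close> of one half of a WZ pair:
  with \<open>f(n,k) = (3n-k+1) c\<^sub>n c\<^bsub>n-k\<^esub> S(n,k)\<close> and \<open>g(n,k) = n c\<^sub>n c\<^bsub>n-1-k\<^esub> S(n,k)\<close> one has
  \<open>4 (f(n,k) - f(n,k+1)) = g(n+1,k) - 16 g(n,k)\<close>. Telescoping turns four times the sum into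
  \<open>n c\<^sub>n Q\<close> with \<open>Q = \<Sum>k<n. S(n,k) c\<^bsub>n-1-k\<^esub>\<close>, so it remains to see that 8 divides \<open>Q\<close>.
  As super Catalan numbers are even, \<open>4 S(m,k) = S(m+1,k) + S(m,k+1)\<close> gives
  \<open>S(n,k) \<equiv> \<plusminus>c\<^bsub>n+k\<^esub>\<close> modulo 8, and the signs do not matter because the products \<open>c\<^sub>i c\<^sub>j\<close> involved are
  divisible by 4. Hence \<open>Q\<close> is congruent to half of the convolution
  \<open>\<Sum>i\<le>2n-1. c\<^sub>i c\<^bsub>2n-1-i\<^esub> = 4\<^bsup>2n-1\<^esup>\<close>.
\<close>

section \<open>Central binomial coefficients: divisibility and convolution\<close>

definition central_binom :: "nat \<Rightarrow> int" where
  "central_binom n = int ((2 * n) choose n)"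

lemma central_binom_0 [simp]: "central_binom 0 = 1"
  by (simp add: central_binom_def)

lemma central_binom_Suc:
  "(int n + 1) * central_binom (Suc n) = 2 * (2 * int n + 1) * central_binom n"
proof -
  have a: "Suc n * ((2 * n + 2) choose Suc n) = (2 * n + 2) * ((2 * n + 1) choose n)"
    using Suc_times_binomial_eq[of "2 * n + 1" n] by (simp add: mult.commute)
  have b: "Suc n * ((2 * n + 1) choose n) = (2 * n + 1) * ((2 * n) choose n)"
    using Suc_times_binomial_eq[of "2 * n" n] binomial_symmetric[of n "2 * n + 1"]
    by (simp add: mult.commute)
  have "Suc n * (Suc n * ((2 * n + 2) choose Suc n))
      = Suc n * (2 * (2 * n + 1) * ((2 * n) choose n))"
    unfolding a using arg_cong[OF b, of "(*) (2 * n + 2)"] by (simp add: algebra_simps)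
  then have "Suc n * ((2 * n + 2) choose Suc n) = 2 * (2 * n + 1) * ((2 * n) choose n)"
    by (metis Suc_neq_Zero mult_cancel1)
  then have "int (Suc n * ((2 * n + 2) choose Suc n)) = int (2 * (2 * n + 1) * ((2 * n) choose n))"
    by presburger
  then show ?thesis
    by (simp add: central_binom_def algebra_simps)
qed

lemma even_central_binom:
  assumes "n > 0"
  shows "even (central_binom n)"
proof -
  obtain m where m: "n = Suc m"
    using assms by (cases n) auto
  have "(2 * n) choose n = (Suc (2 * m) choose m) + (Suc (2 * m) choose Suc m)"
    by (simp add: m)
  also have "Suc (2 * m) choose m = Suc (2 * m) choose Suc m"
    using binomial_symmetric[of m "Suc (2 * m)"] by (simp add: Suc_diff_le)
  finally show ?thesis
    by (simp add: central_binom_def)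
qed

text \<open>In \<open>central_binom_Suc\<close> the right side has two even factors, and the odd
  index on the left cancels modulo 4.\<close>

lemma four_dvd_central_binom_odd:
  assumes "odd n" "n \<ge> 2"
  shows "4 dvd central_binom n"
proof -
  obtain m where m: "n = Suc m"
    using assms by (cases n) auto
  have "2 * 2 dvd 2 * (2 * int m + 1) * central_binom m"
    using even_central_binom[of m] assms m by (intro mult_dvd_mono) auto
  then have "4 dvd (int m + 1) * central_binom n"
    using central_binom_Suc[of m] m by simp
  moreover have "coprime 4 (int m + 1)"
  proof -
    have "coprime (2 ^ 2) (int m + 1)"
      using assms m by (subst coprime_power_left_iff) auto
    then show ?thesis by simp
  qed
  ultimately show ?thesis
    by (simp add: coprime_dvd_mult_right_iff)
qed

text \<open>The generating function (1-4x)^(-1/2) squares to 1/(1-4x). The induction mimics its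
  differential equation by weighting each term with its index.\<close>

lemma sum_central_binom_convolution:
  "(\<Sum>i\<le>n. central_binom i * central_binom (n - i)) = 4 ^ n"
proof (induction n)
  case (Suc n)
  define A where "A m = (\<Sum>i\<le>m. central_binom i * central_binom (m - i))" for m
  define B where "B m = (\<Sum>i\<le>m. int i * (central_binom i * central_binom (m - i)))" for m
  \<comment> \<open>Reflecting \<open>i\<close> to \<open>m - i\<close> shows that the average
    weight is \<open>m / 2\<close>.\<close>
  have weighted: "2 * B m = int m * A m" for m
  proof -
    have "B m = (\<Sum>i\<le>m. int (m - i) * (central_binom (m - i) * central_binom i))"
      unfolding B_def
      by (rule sum.reindex_bij_witness[of _ "\<lambda>i. m - i" "\<lambda>i. m - i"]) auto
    then have "2 * B m = B m + (\<Sum>i\<le>m. int (m - i) * (central_binom (m - i) * central_binom i))"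
      by simp
    also have "\<dots> = (\<Sum>i\<le>m. int m * (central_binom i * central_binom (m - i)))"
      unfolding B_def sum.distrib[symmetric]
      by (intro sum.cong) (auto simp: of_nat_diff algebra_simps)
    finally show ?thesis
      by (simp add: A_def sum_distrib_left)
  qed
  \<comment> \<open>The weight kills the term of index 0, so the recurrence applies to every
    remaining one.\<close>
  have "B (Suc n) = (\<Sum>i\<le>n. ((int i + 1) * central_binom (Suc i)) * central_binom (n - i))"
    unfolding B_def by (subst sum.atMost_Suc_shift) (simp add: algebra_simps)
  also have "\<dots> = 4 * B n + 2 * A n"
    unfolding central_binom_Suc A_def B_def sum_distrib_left sum.distrib[symmetric]
    by (intro sum.cong) (auto simp: algebra_simps)
  finally have "2 * B (Suc n) = 4 * (2 * B n) + 4 * A n"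
    by simp
  then have "int (Suc n) * A (Suc n) = int (Suc n) * (4 * A n)"
    unfolding weighted by (simp add: algebra_simps)
  then have "A (Suc n) = 4 * A n"
    by simp
  then show ?case
    using Suc.IH by (simp add: A_def)
qed simp

text \<open>Reflection of the full convolution swaps its two halves, without a middle term since
  \<open>2 * n - 1\<close> is odd.\<close>

lemma sum_central_binom_half_convolution:
  assumes "n > 0"
  shows "2 * (\<Sum>k<n. central_binom (n + k) * central_binom (n - 1 - k)) = 4 ^ (2 * n - 1)"
proof -
  let ?t = "\<lambda>i. central_binom i * central_binom (2 * n - 1 - i)"
  have "{..2 * n - 1} = {..<n} \<union> {n..<2 * n}"
    using assms by auto
  then have "4 ^ (2 * n - 1) = sum ?t ({..<n} \<union> {n..<2 * n})"
    using sum_central_binom_convolution[of "2 * n - 1"] by simp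
  also have "\<dots> = sum ?t {..<n} + sum ?t {n..<2 * n}"
    by (intro sum.union_disjoint) auto
  also have "sum ?t {..<n} = (\<Sum>k<n. central_binom (n + k) * central_binom (n - 1 - k))"
    by (rule sum.reindex_bij_witness[of _ "\<lambda>k. n - 1 - k" "\<lambda>k. n - 1 - k"])
       (auto simp: mult.commute intro!: arg_cong2[where f = "(*)"] arg_cong[where f = central_binom])
  also have "sum ?t {n..<2 * n} = (\<Sum>k<n. central_binom (n + k) * central_binom (n - 1 - k))"
    by (rule sum.reindex_bij_witness[of _ "\<lambda>k. n + k" "\<lambda>i. i - n"])
       (auto intro!: arg_cong2[where f = "(*)"] arg_cong[where f = central_binom])
  finally show ?thesis
    by simp
qed

text \<open>
  Defining the super Catalan numbers by their recurrence instead of the factorial quotient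
  makes integrality immediate.
\<close>

fun super_catalan :: "nat \<Rightarrow> nat \<Rightarrow> int" where
  "super_catalan m 0 = central_binom m"
| "super_catalan m (Suc k) = 4 * super_catalan m k - super_catalan (Suc m) k"

text \<open>This recovers the ratio of the factorial quotients. In the induction both sides reduce
  to \<open>2 * (2 * k + 1) * super_catalan (Suc m) k\<close>, using the hypothesis at
  \<open>m\<close> and at \<open>Suc m\<close>.\<close>

lemma super_catalan_Suc_left:
  "(int m + int k + 1) * super_catalan (Suc m) k = 2 * (2 * int m + 1) * super_catalan m k"
proof (induction k arbitrary: m)
  case 0
  then show ?case
    using central_binom_Suc[of m] by simp
next
  case (Suc k)
  show ?case
    using Suc[of m] Suc[of "Suc m"] by (simp add: algebra_simps)
qed

lemma super_catalan_Suc_right: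
  "(int m + int k + 1) * super_catalan m (Suc k) = 2 * (2 * int k + 1) * super_catalan m k"
  using super_catalan_Suc_left[of m k] by (simp add: algebra_simps)

lemma even_super_catalan:
  "m > 0 \<Longrightarrow> even (super_catalan m k)"
  by (induction k arbitrary: m) (auto simp: even_central_binom)

lemma super_catalan_mod_8:
  "m > 0 \<Longrightarrow> 8 dvd super_catalan m k - (-1) ^ k * central_binom (m + k)"
proof (induction k arbitrary: m)
  case (Suc k)
  obtain s where "super_catalan m k = 2 * s"
    using even_super_catalan[OF Suc.prems] by blast
  then have "super_catalan m (Suc k) - (-1) ^ Suc k * central_binom (m + Suc k)
      = 8 * s - (super_catalan (Suc m) k - (-1) ^ k * central_binom (Suc m + k))"
    by simp
  also have "8 dvd \<dots>"
    by (rule dvd_diff[OF dvd_triv_left Suc.IH]) simp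
  finally show ?case .
qed simp

section \<open>The convolution Q and its divisibility by 8\<close>

definition super_catalan_conv :: "nat \<Rightarrow> int" where
  "super_catalan_conv n = (\<Sum>k<n. super_catalan n k * central_binom (n - 1 - k))"

lemma eight_dvd_super_catalan_conv:
  assumes "n \<ge> 2"
  shows "8 dvd super_catalan_conv n"
proof -
  define H where "H = (\<Sum>k<n. central_binom (n + k) * central_binom (n - 1 - k))"
  \<comment> \<open>As \<open>n \<ge> 2\<close>, the exponent \<open>2 * n - 1\<close> splits
    without truncation.\<close>
  have "2 * H = 4 ^ (3 + (2 * n - 4))"
    using sum_central_binom_half_convolution[of n] assms by (simp add: H_def)
  then have "H = 8 * (4 * 4 ^ (2 * n - 4))"
    by (simp only: power_add) simp
  then have "8 dvd H" by simp
  moreover have "8 dvd super_catalan_conv n - H"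
    unfolding super_catalan_conv_def H_def sum_subtractf[symmetric]
  proof (rule dvd_sum)
    fix k assume "k \<in> {..<n}"
    then have k: "k < n" by simp
    define p where "p = central_binom (n + k) * central_binom (n - 1 - k)"
    have four: "4 dvd p"
    \<comment> \<open>For \<open>k = n - 1\<close> the second factor is 1, but the first has the odd
      index \<open>2 * n - 1\<close>; otherwise both factors are even.\<close>
    proof (cases "k = n - 1")
      case True
      then show ?thesis
        using four_dvd_central_binom_odd[of "n + k"] assms by (simp add: p_def)
    next
      case False
      then have "2 * 2 dvd p"
        unfolding p_def using k by (intro mult_dvd_mono even_central_binom) auto
      then show ?thesis by simp
    qed
    have "8 dvd ((-1) ^ k - 1) * p"
    proof (cases "even k")
      case False
      have "(-2) * 4 dvd (-2) * p"
        using four by (rule mult_dvd_mono[OF dvd_refl])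
      then show ?thesis
        using False by simp
    qed simp
    moreover have "8 dvd (super_catalan n k - (-1) ^ k * central_binom (n + k))
        * central_binom (n - 1 - k)"
      using super_catalan_mod_8[of n k] assms by simp
    ultimately have "8 dvd (super_catalan n k - (-1) ^ k * central_binom (n + k))
        * central_binom (n - 1 - k) + ((-1) ^ k - 1) * p"
      by (rule dvd_add[rotated])
    then show "8 dvd super_catalan n k * central_binom (n - 1 - k)
        - central_binom (n + k) * central_binom (n - 1 - k)"
      by (simp add: p_def algebra_simps)
  qed
  ultimately show ?thesis
    by (metis diff_add_cancel dvd_add)
qed

text \<open>
  The indices are shifted by \<open>n = m + k + 1\<close>, which avoids truncated subtraction.
\<close>

lemma wz_identity:
  fixes m k :: nat
  defines "n \<equiv> m + k + 1"
  shows "4 * ((3 * int n - int k + 1) * central_binom (Suc m) * super_catalan n k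
           - (3 * int n - int k) * central_binom m * super_catalan n (Suc k))
       = 2 * (2 * int n + 1) * central_binom (Suc m) * super_catalan (Suc n) k
           - 16 * int n * central_binom m * super_catalan n k"
    (is "?L = ?R")
proof -
  define x y where "x = int m" and "y = int k"
  define c d where "c = central_binom m" and "d = central_binom (Suc m)"
  define s u v where "s = super_catalan n k" and "u = super_catalan (Suc n) k"
    and "v = super_catalan n (Suc k)"
  have n: "int n = x + y + 1"
    by (simp add: n_def x_def y_def)
  have d: "(x + 1) * d = 2 * (2 * x + 1) * c"
    using central_binom_Suc[of m] by (simp add: x_def c_def d_def)
  have u: "(x + 2 * y + 2) * u = 2 * (2 * x + 2 * y + 3) * s"
    using super_catalan_Suc_left[of n k] unfolding n by (simp add: y_def s_def u_def algebra_simps)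
  have v: "(x + 2 * y + 2) * v = 2 * (2 * y + 1) * s"
    using super_catalan_Suc_right[of n k] unfolding n by (simp add: y_def s_def v_def algebra_simps)
  \<comment> \<open>Multiplying by the denominators of the three recurrences turns \<open>d\<close>,
    \<open>u\<close> and \<open>v\<close> into polynomial multiples of \<open>c\<close> and
    \<open>s\<close>.\<close>
  have "(x + 1) * (x + 2 * y + 2) * (4 * ((3 * x + 2 * y + 4) * d * s - (3 * x + 2 * y + 3) * c * v))
    = (x + 1) * (x + 2 * y + 2) * (2 * (2 * x + 2 * y + 3) * d * u - 16 * (x + y + 1) * c * s)"
    using d u v by algebra
  moreover have "(x + 1) * (x + 2 * y + 2) \<noteq> 0"
    by (simp add: x_def y_def)
  ultimately have "4 * ((3 * x + 2 * y + 4) * d * s - (3 * x + 2 * y + 3) * c * v)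
      = 2 * (2 * x + 2 * y + 3) * d * u - 16 * (x + y + 1) * c * s"
    by simp
  then show ?thesis
    unfolding n c_def[symmetric] d_def[symmetric] s_def[symmetric] u_def[symmetric]
      v_def[symmetric] y_def[symmetric]
    by (simp add: algebra_simps)
qed

text \<open>Needed at the boundary \<open>k = n\<close> of the telescoping sum.\<close>

lemma super_catalan_Suc_diag: "super_catalan (Suc n) n = 2 * super_catalan n n"
proof -
  have "(2 * int n + 1) * super_catalan (Suc n) n = (2 * int n + 1) * (2 * super_catalan n n)"
    using super_catalan_Suc_left[of n n] by (simp add: algebra_simps)
  then show ?thesis
    by (subst (asm) mult_cancel_left) auto
qed

lemma super_catalan_conv_Suc:
  "int (Suc n) * central_binom (Suc n) * super_catalan_conv (Suc n)
     = 16 * (int n * central_binom n * super_catalan_conv n)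
       + 4 * (3 * int n + 1) * central_binom n ^ 3"
proof -
  \<comment> \<open>The common factor \<open>central_binom n\<close> of the WZ pair is left out here
    and restored after \<open>main\<close>.\<close>
  define f where "f k = (3 * int n - int k + 1) * central_binom (n - k) * super_catalan n k" for k
  define h where "h k = super_catalan n k * central_binom (n - 1 - k)" for k
  define h' where "h' k = super_catalan (Suc n) k * central_binom (n - k)" for k
  have "2 * (2 * int n + 1) * h' k = 4 * (f k - f (Suc k)) + 16 * int n * h k" if "k < n" for k
  proof -
    obtain m where m: "n = m + k + 1"
      using less_imp_Suc_add[OF \<open>k < n\<close>] by (auto simp: add.commute)
    then have "n - k = Suc m" "n - Suc k = m" "n - 1 - k = m"
      by auto
    with wz_identity[of m k] show ?thesis
      unfolding f_def h_def h'_def m[symmetric] by (simp add: algebra_simps)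
  qed
  then have "2 * (2 * int n + 1) * (\<Sum>k<n. h' k)
      = (\<Sum>k<n. 4 * (f k - f (Suc k)) + 16 * int n * h k)"
    unfolding sum_distrib_left by (intro sum.cong) auto
  also have "\<dots> = 4 * (f 0 - f n) + 16 * int n * (\<Sum>k<n. h k)"
    unfolding sum.distrib sum_distrib_left[symmetric] sum_lessThan_telescope' ..
  finally have below: "2 * (2 * int n + 1) * (\<Sum>k<n. h' k)
      = 4 * (f 0 - f n) + 16 * int n * (\<Sum>k<n. h k)" .
  \<comment> \<open>The telescoping remainder \<open>- 4 * f n\<close> is exactly offset by the
    extra term \<open>k = n\<close> of the sum for \<open>Suc n\<close>.\<close>
  have "4 * f n = 2 * (2 * int n + 1) * h' n"
    by (simp add: f_def h'_def super_catalan_Suc_diag)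
  with below have "2 * (2 * int n + 1) * (\<Sum>k<Suc n. h' k) = 4 * f 0 + 16 * int n * (\<Sum>k<n. h k)"
    by (simp add: algebra_simps)
  then have main: "2 * (2 * int n + 1) * super_catalan_conv (Suc n)
      = 4 * ((3 * int n + 1) * central_binom n ^ 2) + 16 * int n * super_catalan_conv n"
    by (simp add: super_catalan_conv_def h_def h'_def f_def power2_eq_square)
  have "int (Suc n) * central_binom (Suc n) * super_catalan_conv (Suc n)
      = central_binom n * (2 * (2 * int n + 1) * super_catalan_conv (Suc n))"
    using central_binom_Suc[of n] by (simp add: algebra_simps)
  also have "\<dots> = 16 * (int n * central_binom n * super_catalan_conv n)
       + 4 * (3 * int n + 1) * central_binom n ^ 3"
    unfolding main by (simp add: algebra_simps power2_eq_square power3_eq_cube)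
  finally show ?thesis .
qed

lemma four_times_sum_eq:
  "4 * (\<Sum>k<n. (3 * int k + 1) * central_binom k ^ 3 * 16 ^ (n - 1 - k))
     = int n * central_binom n * super_catalan_conv n"
proof (induction n)
  case (Suc n)
  have "(\<Sum>k<n. (3 * int k + 1) * central_binom k ^ 3 * 16 ^ (n - k))
      = 16 * (\<Sum>k<n. (3 * int k + 1) * central_binom k ^ 3 * 16 ^ (n - 1 - k))"
    unfolding sum_distrib_left
  proof (rule sum.cong)
    fix k assume "k \<in> {..<n}"
    then have "n - k = Suc (n - 1 - k)" by auto
    then show "(3 * int k + 1) * central_binom k ^ 3 * 16 ^ (n - k)
        = 16 * ((3 * int k + 1) * central_binom k ^ 3 * 16 ^ (n - 1 - k))"
      by simp
  qed simp
  then show ?case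
    unfolding super_catalan_conv_Suc Suc.IH[symmetric] by simp
qed simp

theorem theorem1p1:
  fixes n :: nat
  assumes "n \<ge> 2"
  shows "2 * int n * int ((2 * n) choose n) dvd
    (\<Sum>k = 0..n - 1. (3 * int k + 1) * int ((2 * k) choose k) ^ 3 * 16 ^ (n - 1 - k))"
proof -
  obtain t where t: "super_catalan_conv n = 8 * t"
    using eight_dvd_super_catalan_conv[OF assms] by blast
  have "{0..n - 1} = {..<n}"
    using assms by auto
  then have "(\<Sum>k = 0..n - 1. (3 * int k + 1) * int ((2 * k) choose k) ^ 3 * 16 ^ (n - 1 - k))
      = 2 * int n * int ((2 * n) choose n) * t"
    using four_times_sum_eq[of n] t by (simp add: central_binom_def)
  then show ?thesis
    by simp
qed

end
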